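(* Let $k\in\mathbb{N}$, $\mathrm{Re}(z)>1$, $IpP_{k+1}=[p_k+1,\;p_k(p_k+4)+3]$, let $pP_{k+1}=\varphi([p_k+1,\;p_k(p_k+4)+3])$ be the set of all primes in $IpP_{k+1}$, let $\pi(pP_{k+1})=|pP_{k+1}|$, and write $$\Big(1-\frac1{p_k^z}\Big)\Big(1-\frac1{p_{k-1}^z}\Big)\cdots\Big(1-\frac1{3^z}\Big)\Big(1-\frac1{2^z}\Big)\zeta(z)=1+\frac1{n_1^z}+\frac1{n_2^z}+\cdots,$$ with integers $1<n_1<n_2<\cdots$ not depending on $z$. Then $n_1=p_{k+1}$, $n_2=p_{k+2}$, $\ldots$, $n_{\pi(pP_{k+1})}=p_{k+\pi(pP_{k+1})}$, and these belong to $pP_{k+1}=\varphi([p_k+1,\;p_k(p_k+4)+3])$.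
   Context: $\mathbb{N}=\{1,2,\ldots\}$. For $m\le n$ in $\mathbb{N}$, $[m,n]=\{k\in\mathbb{N}: m\le k\le n\}$. $p_1=2,p_2=3,\ldots$ are the primes in increasing order; the product on the left-hand side runs over the factors $1-p_i^{-z}$ for $i=1,\ldots,k$. For $S\subseteq\mathbb{N}$, $\varphi(S)$ is the set of all primes in $S$. $\zeta(z)=\frac1{1^z}+\frac1{2^z}+\frac1{3^z}+\cdots$ for $\mathrm{Re}(z)>1$ is the Riemann zeta function.
   Formalization: The formal statement requires k ≥ 2 instead of k ≥ 1; for k = 1 the claim fails, since the interval is [3,15] with 5 primes, but n_4 = 9 while p_5 = 11. *)

theory Defs
  imports "HOL-Analysis.Analysis" "HOL-Computational_Algebra.Primes"
begin

text \<open>Indexed from 1: \<open>nth_prime 1 = 2\<close>. The value at \<open>0\<close> is junk.\<close>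

definition nth_prime :: "nat \<Rightarrow> nat" where
  "nth_prime i = enumerate {p. prime p} (i - 1)"

text \<open>Only meaningful for \<open>Re z > 1\<close>, where the series converges.\<close>

definition zeta :: "complex \<Rightarrow> complex" where
  "zeta z = (\<Sum>m. 1 / of_nat (Suc m) powr z)"

definition primes_in :: "nat set \<Rightarrow> nat set" where
  "primes_in S = {q \<in> S. prime q}"

text \<open>The sets attached to \<open>p\<^sub>k\<close> carry the index \<open>k + 1\<close>, hence the shift.\<close>

definition IpP :: "nat \<Rightarrow> nat set" where
  "IpP j = (let p = nth_prime (j - 1) in {p + 1 .. p * (p + 4) + 3})"

definition pP :: "nat \<Rightarrow> nat set" where
  "pP j = primes_in (IpP j)"

text \<open>
  The sequence \<open>n 1 < n 2 < \<dots>\<close> is indexed from 1 (\<open>n 0\<close> is unconstrained), and one and the same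
  sequence has to serve all \<open>z\<close> in the half-plane.
\<close>

definition sieved_zeta_expansion :: "nat \<Rightarrow> (nat \<Rightarrow> nat) \<Rightarrow> bool" where
  "sieved_zeta_expansion k n \<longleftrightarrow>
     1 < n 1 \<and> strict_mono_on {1..} n \<and>
     (\<forall>z. Re z > 1 \<longrightarrow>
        summable (\<lambda>j. 1 / of_nat (n (Suc j)) powr z) \<and>
        (\<Prod>i=1..k. 1 - 1 / of_nat (nth_prime i) powr z) * zeta z
          = 1 + (\<Sum>j. 1 / of_nat (n (Suc j)) powr z))"

end

theory Submission
  imports Defs
begin

text \<open>
  Removing the multiples of \<open>2, 3, \<dots>, p\<^sub>k\<close> from the Dirichlet series of zeta one prime at a time
  leaves the series over all \<open>m\<close> without prime factors \<open>\<le> p\<^sub>k\<close>. A Dirichlet series with bounded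
  coefficients determines its coefficients, so the \<open>n\<^sub>i\<close> are exactly these \<open>m > 1\<close> in increasing
  order. As \<open>p\<^sub>k\<close> is odd, all their prime factors are at least \<open>p\<^sub>k + 2\<close>, so those up to
  \<open>p\<^sub>k (p\<^sub>k + 4) + 3 = (p\<^sub>k + 2)\<^sup>2 - 1\<close> are prime.
\<close>

section \<open>Sieving the Dirichlet series of zeta\<close>

text \<open>Absolute convergence turns the ordered series into an unordered sum, so that index sets
  can be reindexed and subtracted freely.\<close>

lemma has_sum_zeta:
  assumes "Re z > 1"
  shows "((\<lambda>m. 1 / of_nat m powr z) has_sum zeta z) {0<..}"
proof -
  have "summable (\<lambda>m. real m powr - Re z)"
    using assms by (subst summable_real_powr_iff) auto
  moreover have "norm (1 / of_nat m powr z) = real m powr - Re z" for m :: nat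
    by (simp add: norm_divide norm_powr_real_powr powr_minus_divide)
  ultimately have "summable (\<lambda>m. norm (1 / of_nat m powr z :: complex))"
    by simp
  then have "summable (\<lambda>m. norm (1 / of_nat (Suc m) powr z :: complex))"
    by (subst summable_Suc_iff)
  then have "((\<lambda>m. 1 / of_nat (Suc m) powr z) has_sum zeta z) UNIV"
    unfolding zeta_def
    by (simp only: norm_summable_imp_has_sum summable_sums summable_norm_cancel)
  then show ?thesis
    unfolding greaterThan_0 by (subst has_sum_reindex) (auto simp only: inj_Suc comp_def)
qed

text \<open>Multiplying the sum over the surviving indices by \<open>1 / of_nat p powr z\<close>
  gives the sum over those survivors that are multiples of \<open>p\<close>; the new factor
  therefore deletes exactly these.\<close>

lemma has_sum_zeta_sieved:
  assumes z: "Re z > 1" and "finite F" "\<And>p. p \<in> F \<Longrightarrow> prime p"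
  shows "((\<lambda>m. 1 / of_nat m powr z) has_sum (\<Prod>p\<in>F. 1 - 1 / of_nat p powr z) * zeta z)
           {m. 0 < m \<and> (\<forall>p\<in>F. \<not> p dvd m)}"
  using assms(2,3)
proof (induction F rule: finite_induct)
  case empty
  then show ?case
    using has_sum_zeta[OF z] by (simp add: greaterThan_def)
next
  case (insert p F)
  let ?R = "{m. 0 < m \<and> (\<forall>q\<in>F. \<not> q dvd m)}"
  let ?f = "\<lambda>m::nat. 1 / of_nat m powr z"
  let ?S = "(\<Prod>q\<in>F. 1 - 1 / of_nat q powr z) * zeta z"
  have p: "prime p" and F: "\<And>q. q \<in> F \<Longrightarrow> prime q"
    using insert.prems by auto
  have IH: "(?f has_sum ?S) ?R"
    using insert.IH F by auto
  have "((\<lambda>m. ?f p * ?f m) has_sum ?f p * ?S) ?R"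
    by (rule has_sum_cmult_right[OF IH])
  moreover have "?f p * ?f m = ?f (p * m)" for m
    by (simp add: powr_times_real)
  moreover have "inj_on ((*) p) ?R"
    using p by (auto simp: inj_on_def)
  ultimately have "(?f has_sum ?f p * ?S) ((*) p ` ?R)"
    by (subst has_sum_reindex) (auto simp: comp_def)
  \<comment> \<open>\<open>p\<close> is not in \<open>F\<close>, so no prime of \<open>F\<close>
    divides \<open>p\<close>, and multiplication by \<open>p\<close> preserves survival.\<close>
  moreover have "(*) p ` ?R \<subseteq> ?R"
  proof -
    have "\<not> q dvd p * m" if "q \<in> F" "\<not> q dvd m" for q m
      using that F p insert.hyps by (metis prime_dvd_mult_iff primes_dvd_imp_eq)
    then show ?thesis
      using p by (auto simp: prime_gt_0_nat)
  qed
  ultimately have "(?f has_sum ?S - ?f p * ?S) (?R - (*) p ` ?R)"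
    by (intro has_sum_Diff IH)
  moreover have "?R - (*) p ` ?R = {m. 0 < m \<and> (\<forall>q\<in>insert p F. \<not> q dvd m)}"
  proof -
    have "m \<in> (*) p ` ?R" if m: "m \<in> ?R" "p dvd m" for m
    proof -
      obtain l where l: "m = p * l"
        using m(2) by blast
      then have "l \<in> ?R"
        using m(1) by auto
      with l show ?thesis
        by blast
    qed
    then show ?thesis
      by auto
  qed
  moreover have "?S - ?f p * ?S = (\<Prod>q\<in>insert p F. 1 - 1 / of_nat q powr z) * zeta z"
    using insert.hyps by (simp add: algebra_simps)
  ultimately show ?case
    by simp
qed

section \<open>Uniqueness of Dirichlet coefficients\<close>

text \<open>Multiplying by \<open>N ^ s\<close>, where \<open>N\<close> is the first index with \<open>c N \<noteq> 0\<close>, makes every term past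
  \<open>N\<close> decay at least like \<open>(N / (N + 1)) ^ s\<close> as \<open>s \<rightarrow> \<infinity>\<close>.\<close>

lemma dirichlet_series_eq_0:
  fixes c :: "nat \<Rightarrow> complex"
  assumes bdd: "\<And>m. norm (c m) \<le> K"
    and sums: "\<And>s. s \<ge> 2 \<Longrightarrow> (\<lambda>m. c m / of_nat m ^ s) sums 0"
    and "m > 0"
  shows "c m = 0"
proof (rule ccontr)
  assume "c m \<noteq> 0"
  define N where "N = (LEAST n. n > 0 \<and> c n \<noteq> 0)"
  have N: "N > 0" "c N \<noteq> 0"
    using LeastI[of "\<lambda>n. n > 0 \<and> c n \<noteq> 0" m] \<open>c m \<noteq> 0\<close> \<open>m > 0\<close> by (auto simp: N_def)
  have below: "c n = 0" if "0 < n" "n < N" for n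
    using not_less_Least[of n "\<lambda>n. n > 0 \<and> c n \<noteq> 0"] that by (auto simp: N_def)
  define q where "q = real N / real (Suc N)"
  \<comment> \<open>The exponent is split as \<open>t + 2\<close>: two factors give a summable
    majorant \<open>g\<close> independent of \<open>t\<close>, the other \<open>t\<close> give
    \<open>q ^ t\<close>.\<close>
  define g where "g = (\<lambda>n. K * (real N / real (n + Suc N)) ^ 2)"
  have g: "summable g"
  proof -
    have "summable (\<lambda>n. 1 / real n ^ 2)"
      using inverse_power_summable[of 2] by (simp add: field_simps)
    then have "summable (\<lambda>n. 1 / real (n + Suc N) ^ 2)"
      by (rule summable_ignore_initial_segment)
    from summable_mult[OF this, of "K * real N ^ 2"] show ?thesis
      by (simp add: g_def power_divide)
  qed
  have bound: "norm (c N) \<le> suminf g * q ^ t" for t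
  proof -
    define f where "f = (\<lambda>n. of_nat N ^ (t + 2) * (c n / of_nat n ^ (t + 2)))"
    have "f sums 0"
      using sums_mult[OF sums[of "t + 2"], of "of_nat N ^ (t + 2)"] by (simp add: f_def)
    then have "(\<lambda>n. f (n + Suc N)) sums (0 - sum f {..<Suc N})"
      by (rule sums_split_initial_segment)
    moreover have "sum f {..<Suc N} = c N"
    proof -
      \<comment> \<open>\<open>c 0\<close> is arbitrary, but the term at \<open>0\<close> vanishes
        because division by zero yields zero.\<close>
      have "f n = 0" if "n < N" for n
        using below[of n] that by (cases "n = 0") (auto simp: f_def)
      then have "sum f {..<Suc N} = f N"
        by simp
      then show ?thesis
        using N by (simp add: f_def)
    qed
    ultimately have *: "(\<lambda>n. f (n + Suc N)) sums (- c N)"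
      by (simp only: diff_0)
    have le: "norm (f (n + Suc N)) \<le> g n * q ^ t" for n
    proof -
      let ?r = "real N / real (n + Suc N)"
      have "norm (f (n + Suc N)) = norm (c (n + Suc N)) * ?r ^ 2 * ?r ^ t"
        unfolding f_def norm_mult norm_divide norm_power norm_of_nat power_divide power_add
        by (simp add: mult_ac)
      also have "\<dots> \<le> K * ?r ^ 2 * q ^ t"
        by (intro mult_mono bdd power_mono mult_nonneg_nonneg order.trans[OF norm_ge_zero bdd])
           (auto simp: q_def frac_le)
      finally show ?thesis
        by (simp add: g_def)
    qed
    have "norm (c N) = norm (\<Sum>n. f (n + Suc N))"
      using sums_unique[OF *] by (metis norm_minus_cancel)
    also have "\<dots> \<le> (\<Sum>n. g n * q ^ t)"
      by (rule norm_suminf_le[OF le summable_mult2[OF g]])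
    also have "\<dots> = suminf g * q ^ t"
      by (rule suminf_mult2[OF g, symmetric])
    finally show ?thesis .
  qed
  have "(\<lambda>t. q ^ t) \<longlonglongrightarrow> 0"
    by (rule LIMSEQ_realpow_zero) (auto simp: q_def)
  then have "(\<lambda>t. suminf g * q ^ t) \<longlonglongrightarrow> suminf g * 0"
    by (rule tendsto_mult_left)
  then have "norm (c N) \<le> suminf g * 0"
    by (rule LIMSEQ_le_const) (use bound in blast)
  then show False
    using N by simp
qed

text \<open>At integers \<open>s \<ge> 2\<close>, \<open>dirichlet_series_eq_0\<close> applies to
  the difference of the two indicators, since \<open>A\<close> and \<open>B\<close> stay fixed while
  \<open>z\<close> varies. The index \<open>0\<close> contributes zero to either sum and would go
  undetected, so it is excluded.\<close>

lemma dirichlet_series_set_unique: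
  assumes "\<And>z. Re z > 1 \<Longrightarrow> ((\<lambda>m. 1 / of_nat m powr z) has_sum S z) A"
    and "\<And>z. Re z > 1 \<Longrightarrow> ((\<lambda>m. 1 / of_nat m powr z) has_sum S z) B"
    and "0 \<notin> A" "0 \<notin> B"
  shows "A = B"
proof -
  define c :: "nat \<Rightarrow> complex" where "c = (\<lambda>m. of_bool (m \<in> A) - of_bool (m \<in> B))"
  have indicat: "((\<lambda>m. of_bool (m \<in> X) / of_nat m ^ s) has_sum S (of_nat s)) UNIV"
    if "((\<lambda>m. 1 / of_nat m powr (of_nat s :: complex)) has_sum S (of_nat s)) X" "s \<ge> 2" for X s
    using that(1)
    by (rule has_sum_cong_neutral[THEN iffD1, rotated -1]) (use that(2) in \<open>auto simp: powr_nat'\<close>)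
  have "c m = 0" if "m > 0" for m
  proof (rule dirichlet_series_eq_0[of c 1, OF _ _ that])
    show "norm (c m) \<le> 1" for m
      by (simp add: c_def)
    show "(\<lambda>m. c m / of_nat m ^ s) sums 0" if "s \<ge> 2" for s
    proof -
      have "(\<lambda>m. of_bool (m \<in> A) / of_nat m ^ s - of_bool (m \<in> B) / of_nat m ^ s)
              sums (S (of_nat s) - S (of_nat s))"
        using that by (intro sums_diff has_sum_imp_sums indicat assms) auto
      then show ?thesis
        by (simp add: c_def diff_divide_distrib)
    qed
  qed
  then have eq: "m \<in> A \<longleftrightarrow> m \<in> B" if "m > 0" for m
    using that unfolding c_def eq_iff_diff_eq_0[symmetric] of_bool_eq_iff .
  show ?thesis
  proof (rule set_eqI)
    show "m \<in> A \<longleftrightarrow> m \<in> B" for m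
      using assms(3,4) eq[of m] by (cases "m = 0") auto
  qed
qed

section \<open>Comparing increasing enumerations\<close>

text \<open>An increasing enumeration is determined by its range, and its values up to
  \<open>L\<close> by the part of the range up to \<open>L\<close>. The cardinality tells how many
  terms lie in that part.\<close>

lemma strict_mono_eq_initial_segment:
  fixes f g :: "nat \<Rightarrow> nat"
  assumes f: "strict_mono f" and g: "strict_mono g"
    and eq: "range f \<inter> {..L} = range g \<inter> {..L}"
    and "j < card (range g \<inter> {..L})"
  shows "f j = g j \<and> g j \<le> L"
proof -
  have agree: "f i = g i" if "g i \<le> L" for i
    using that
  proof (induction i rule: less_induct)
    case (less i)
    have IH: "f l = g l" if "l < i" for l
      using less that strict_mono_less[OF g, of l i] by auto
    have "g i \<in> range f"
      using eq less.prems by blast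
    then obtain l where l: "g i = f l"
      by auto
    \<comment> \<open>For an earlier \<open>l\<close>, \<open>f l = g l\<close> would repeat the
      value \<open>g i\<close>. The same argument with roles exchanged gives the other
      inequality.\<close>
    have "\<not> l < i"
      using IH[of l] l strict_mono_eq[OF g] by auto
    then have 1: "f i \<le> g i"
      using l strict_mono_less_eq[OF f] by simp
    then have "f i \<in> range g"
      using eq less.prems by fastforce
    then obtain l' where l': "f i = g l'"
      by auto
    have "\<not> l' < i"
      using IH[of l'] l' strict_mono_eq[OF f, of l' i] by auto
    then have "g i \<le> f i"
      using l' strict_mono_less_eq[OF g] by simp
    with 1 show ?case
      by simp
  qed
  \<comment> \<open>Otherwise only the \<open>j\<close> values of \<open>g\<close> before
    \<open>g j\<close> could be at most \<open>L\<close>, too few for the assumed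
    cardinality.\<close>
  have "g j \<le> L"
  proof (rule ccontr)
    assume "\<not> g j \<le> L"
    then have "i < j" if "g i \<le> L" for i
      using that strict_mono_less[OF g, of i j] by linarith
    then have "range g \<inter> {..L} \<subseteq> g ` {..<j}"
      by auto
    then have "card (range g \<inter> {..L}) \<le> card (g ` {..<j})"
      by (intro card_mono) auto
    also have "\<dots> \<le> j"
      using card_image_le[of "{..<j}" g] by simp
    finally have "card (range g \<inter> {..L}) \<le> j" .
    with assms(4) show False
      by simp
  qed
  with agree show ?thesis
    by simp
qed

section \<open>Enumeration of the primes\<close>

lemma prime_nth_prime: "prime (nth_prime i)"
  using enumerate_in_set[OF primes_infinite] by (simp add: nth_prime_def)

lemma nth_prime_less_iff:
  assumes "i > 0" "j > 0"
  shows "nth_prime i < nth_prime j \<longleftrightarrow> i < j"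
  using assms by (auto simp: nth_prime_def enumerate_mono_iff[OF primes_infinite])

lemma ex_nth_prime:
  assumes "prime q"
  obtains i where "i > 0" "q = nth_prime i"
proof -
  obtain n where "enumerate {p. prime p} n = q"
    using enumerate_Ex[OF primes_infinite, of q] assms by auto
  then show ?thesis
    using that[of "Suc n"] by (simp add: nth_prime_def)
qed

lemma range_nth_prime_shift:
  assumes "k > 0"
  shows "range (\<lambda>j. nth_prime (k + Suc j)) = {q. prime q \<and> nth_prime k < q}"
proof (intro equalityI subsetI)
  fix q assume "q \<in> {q. prime q \<and> nth_prime k < q}"
  then obtain i where i: "i > 0" "q = nth_prime i" "nth_prime k < nth_prime i"
    using ex_nth_prime by auto
  then have "k < i"
    using assms nth_prime_less_iff by blast
  then have "q = nth_prime (k + Suc (i - Suc k))"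
    using i(2) by simp
  then show "q \<in> range (\<lambda>j. nth_prime (k + Suc j))"
    by (rule range_eqI)
qed (use assms in \<open>auto simp: prime_nth_prime nth_prime_less_iff\<close>)

lemma nth_prime_le_iff:
  assumes "i > 0" "j > 0"
  shows "nth_prime i \<le> nth_prime j \<longleftrightarrow> i \<le> j"
  using nth_prime_less_iff[OF assms(2,1)] by (simp add: not_less[symmetric])

lemma nth_prime_image:
  assumes "k > 0"
  shows "nth_prime ` {1..k} = {q. prime q \<and> q \<le> nth_prime k}"
proof (intro equalityI subsetI)
  fix q assume q: "q \<in> {q. prime q \<and> q \<le> nth_prime k}"
  then obtain j where "j > 0" "q = nth_prime j"
    using ex_nth_prime by blast
  with q assms show "q \<in> nth_prime ` {1..k}"
    by (auto simp: nth_prime_le_iff)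
qed (auto simp: prime_nth_prime nth_prime_le_iff)

section \<open>Rough numbers and the sieved series\<close>

text \<open>For \<open>k > 0\<close>, the survivors of the sieve by the first \<open>k\<close>
  primes, except \<open>1\<close>, which supplies the constant term of the expansion.\<close>

definition rough_numbers :: "nat \<Rightarrow> nat set" where
  "rough_numbers k = {m. 1 < m \<and> (\<forall>q. prime q \<longrightarrow> q dvd m \<longrightarrow> nth_prime k < q)}"

lemma prime_in_rough_numbers:
  assumes "prime q"
  shows "q \<in> rough_numbers k \<longleftrightarrow> nth_prime k < q"
  using assms primes_dvd_imp_eq[of _ q] by (auto simp: rough_numbers_def prime_gt_Suc_0_nat)

text \<open>All primes above \<open>nth_prime k\<close> are rough. Infinitude lets
  \<open>enumerate\<close> produce a strictly increasing sequence.\<close>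

lemma infinite_rough_numbers: "infinite (rough_numbers k)"
proof
  assume "finite (rough_numbers k)"
  moreover have "{q. prime q} \<subseteq> rough_numbers k \<union> {..nth_prime k}"
    using prime_in_rough_numbers by (auto simp: not_le)
  ultimately show False
    using primes_infinite finite_subset by blast
qed

lemma prod_zeta_has_sum:
  assumes "Re z > 1" "k > 0"
  shows "((\<lambda>m. 1 / of_nat m powr z) has_sum
            (\<Prod>i=1..k. 1 - 1 / of_nat (nth_prime i) powr z) * zeta z - 1) (rough_numbers k)"
proof -
  let ?F = "nth_prime ` {1..k}" and ?f = "\<lambda>m::nat. 1 / of_nat m powr z"
  note F = nth_prime_image[OF \<open>k > 0\<close>]
  let ?R = "{m. 0 < m \<and> (\<forall>p\<in>?F. \<not> p dvd m)}"
  have "inj_on nth_prime {1..k}"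
    by (intro inj_onI antisym) (auto simp flip: nth_prime_le_iff)
  then have "(?f has_sum (\<Prod>i=1..k. 1 - 1 / of_nat (nth_prime i) powr z) * zeta z) ?R"
    using has_sum_zeta_sieved[OF assms(1), of ?F] prime_nth_prime
    by (auto simp: prod.reindex comp_def)
  moreover have "(?f has_sum 1) {1}"
    by (rule has_sum_finiteI) auto
  moreover have "nth_prime i \<noteq> 1" for i
    using prime_nth_prime[of i] by auto
  then have "1 \<in> ?R"
    by auto
  ultimately have "(?f has_sum (\<Prod>i=1..k. 1 - 1 / of_nat (nth_prime i) powr z) * zeta z - 1)
                     (?R - {1})"
    by (intro has_sum_Diff) auto
  moreover have "?R - {1} = rough_numbers k"
    unfolding rough_numbers_def F by (auto simp: not_le)
  ultimately show ?thesis
    by simp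
qed

lemma strict_mono_shift:
  "strict_mono_on {1..} n \<Longrightarrow> strict_mono (\<lambda>j. n (Suc j))"
  by (auto simp: strict_mono_def strict_mono_on_def)

text \<open>This trades the analytic identity for a description of the range. Forward, uniqueness of
  Dirichlet series applies; backward, the unordered sum over the rough numbers is listed along
  \<open>n\<close>.\<close>

lemma sieved_zeta_expansion_iff:
  assumes "k > 0"
  shows "sieved_zeta_expansion k n \<longleftrightarrow>
           strict_mono_on {1..} n \<and> range (\<lambda>j. n (Suc j)) = rough_numbers k"
proof
  let ?h = "\<lambda>j. n (Suc j)" and ?f = "\<lambda>z m::nat. 1 / of_nat m powr z"
  let ?S = "\<lambda>z. (\<Prod>i=1..k. 1 - 1 / of_nat (nth_prime i) powr z) * zeta z - 1"
  {
    assume n: "sieved_zeta_expansion k n"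
    then have mono: "strict_mono ?h"
      by (auto simp: sieved_zeta_expansion_def intro: strict_mono_shift)
    \<comment> \<open>Monotonicity and \<open>1 < n 1\<close> keep \<open>0\<close> out of the
      range.\<close>
    have "?h 0 \<le> ?h j" for j
      using strict_mono_less_eq[OF mono] by blast
    then have pos: "?h j > 0" for j
      using n by (metis One_nat_def gr_zeroI less_nat_zero_code not_less sieved_zeta_expansion_def)
    have sum: "(?f z has_sum ?S z) (range ?h)" if z: "Re z > 1" for z
    proof -
      \<comment> \<open>The sum over the range is a subsum of zeta, hence converges unconditionally;
        the ordered series then identifies its value.\<close>
      have "?f z summable_on {0<..}"
        using has_sum_zeta[OF z] by (rule has_sum_imp_summable)
      then have "?f z summable_on range ?h"
        by (rule summable_on_subset_banach) (use pos in auto)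
      then obtain s where s: "(?f z has_sum s) (range ?h)"
        by (auto simp: summable_on_def)
      then have "((\<lambda>j. ?f z (?h j)) has_sum s) UNIV"
        using has_sum_reindex[OF strict_mono_imp_inj_on[OF mono], of "?f z"]
        by (simp add: comp_def)
      then have "(\<lambda>j. ?f z (?h j)) sums s"
        by (rule has_sum_imp_sums)
      then have "s = ?S z"
        using n z by (auto simp: sieved_zeta_expansion_def dest: sums_unique)
      with s show ?thesis
        by simp
    qed
    have "range ?h = rough_numbers k"
    proof (rule dirichlet_series_set_unique[OF sum prod_zeta_has_sum])
      show "0 \<notin> range ?h"
        using pos by (metis imageE less_irrefl)
    qed (use assms in \<open>auto simp: rough_numbers_def\<close>)
    with n show "strict_mono_on {1..} n \<and> range ?h = rough_numbers k"
      by (simp add: sieved_zeta_expansion_def)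
  next
    assume n: "strict_mono_on {1..} n \<and> range ?h = rough_numbers k"
    then have "inj ?h"
      using strict_mono_imp_inj_on[OF strict_mono_shift] by blast
    then have "(\<lambda>j. ?f z (?h j)) sums ?S z" if "Re z > 1" for z
      using prod_zeta_has_sum[OF that assms] has_sum_reindex[of ?h UNIV "?f z" "?S z"] n
      by (intro has_sum_imp_sums) (simp add: comp_def)
    moreover have "1 < n 1"
      using n by (auto simp: rough_numbers_def)
    ultimately show "sieved_zeta_expansion k n"
      using n unfolding sieved_zeta_expansion_def
      by (auto simp: sums_iff dest: sums_summable)
  }
qed

section \<open>Primality and the first terms\<close>

text \<open>A composite \<open>m\<close> is a product of two factors above \<open>1\<close>, each
  with a prime divisor beyond \<open>nth_prime k\<close>; parity lifts both factors to at least
  \<open>nth_prime k + 2\<close>.\<close>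

lemma prime_rough_number:
  assumes "k \<ge> 2" "m \<in> rough_numbers k" "m < (nth_prime k + 2) ^ 2"
  shows "prime m"
proof (rule ccontr)
  assume "\<not> prime m"
  have large: "nth_prime k + 2 \<le> a" if "1 < a" "a dvd m" for a
  proof -
    obtain q where q: "prime q" "q dvd a"
      using prime_factor_nat[of a] \<open>1 < a\<close> by blast
    then have "nth_prime k < q"
      using assms(2) that(2) dvd_trans by (auto simp: rough_numbers_def)
    \<comment> \<open>\<open>k \<ge> 2\<close> excludes the prime \<open>2\<close>, and distinct odd
      numbers differ by at least two.\<close>
    moreover have "nth_prime 1 < nth_prime k"
      using assms(1) by (subst nth_prime_less_iff) auto
    then have "2 < nth_prime k"
      using prime_ge_2_nat[OF prime_nth_prime[of 1]] by simp
    then have "odd (nth_prime k)" "odd q"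
      using \<open>nth_prime k < q\<close> q(1) prime_nth_prime[of k] prime_odd_nat by auto
    ultimately have "nth_prime k + 2 \<le> q"
      by presburger
    also have "q \<le> a"
      using q(2) that(1) by (simp add: dvd_imp_le)
    finally show ?thesis .
  qed
  have "1 < m"
    using assms(2) by (simp add: rough_numbers_def)
  then obtain a b where ab: "m = a * b" "a \<noteq> 1" "a \<noteq> m"
    using \<open>\<not> prime m\<close> by (auto simp: prime_nat_iff dvd_def)
  then have "a \<noteq> 0" "b \<noteq> 0" "b \<noteq> 1"
    using \<open>1 < m\<close> by (auto intro: Nat.gr0I)
  with ab(2) have "1 < a" "1 < b"
    by linarith+
  with ab(1) have "(nth_prime k + 2) * (nth_prime k + 2) \<le> m"
    using large[of a] large[of b] by (simp add: mult_le_mono del: mult_Suc mult_Suc_right)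
  with assms(3) show False
    by (simp add: power2_eq_square)
qed

text \<open>Existence keeps the claim about all expansions from being vacuous. For
  \<open>k = 1\<close> the claim fails: the indices are \<open>3, 5, 7, 9, ...\<close>, and
  \<open>9 \<le> 15\<close> is composite, so \<open>n 4\<close> is not
  \<open>nth_prime 5 = 11\<close>.\<close>

theorem proposition5p1:
  fixes k :: nat
  assumes "k \<ge> 2"
  shows "(\<exists>n. sieved_zeta_expansion k n) \<and>
    (\<forall>n. sieved_zeta_expansion k n \<longrightarrow>
       (\<forall>i\<in>{1..card (pP (k + 1))}.
          n i = nth_prime (k + i) \<and> n i \<in> pP (k + 1)))"
proof (intro conjI allI impI ballI)
  have "k > 0"
    using assms by simp
  note expansion_iff = sieved_zeta_expansion_iff[OF this]
  \<comment> \<open>The witness lists the rough numbers; \<open>enumerate\<close> starts at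
    \<open>0\<close> and the expansion at \<open>1\<close>, hence \<open>i - 1\<close>.\<close>
  let ?e = "enumerate (rough_numbers k)"
  have "range ?e = rough_numbers k"
    using bij_enumerate[OF infinite_rough_numbers] by (auto simp: bij_betw_def)
  moreover have "strict_mono_on {1..} (\<lambda>i. ?e (i - 1))"
    by (auto simp: strict_mono_on_def enumerate_mono_iff[OF infinite_rough_numbers])
  ultimately have "sieved_zeta_expansion k (\<lambda>i. ?e (i - 1))"
    by (simp add: expansion_iff)
  then show "\<exists>n. sieved_zeta_expansion k n"
    by blast

  fix n i
  assume n: "sieved_zeta_expansion k n" and i: "i \<in> {1..card (pP (k + 1))}"
  define p where "p = nth_prime k"
  define L where "L = p * (p + 4) + 3"
  let ?g = "\<lambda>j. nth_prime (k + Suc j)"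
  have L: "m \<le> L \<longleftrightarrow> m < (p + 2) ^ 2" for m
    by (auto simp: L_def power2_eq_square algebra_simps)
  have pP: "pP (k + 1) = range ?g \<inter> {..L}"
    unfolding range_nth_prime_shift[OF \<open>k > 0\<close>]
    by (auto simp: pP_def primes_in_def IpP_def Let_def p_def L_def)
  \<comment> \<open>Up to \<open>L\<close>, the rough numbers are just the primes beyond
    \<open>p\<close>, although the two sets differ further out.\<close>
  have "rough_numbers k \<inter> {..L} = range ?g \<inter> {..L}"
    unfolding range_nth_prime_shift[OF \<open>k > 0\<close>]
    using prime_rough_number[OF assms] prime_in_rough_numbers L by (auto simp: p_def)
  \<comment> \<open>\<open>i\<close> counts from \<open>1\<close> and the compared sequences from
    \<open>0\<close>, so the upper bound on \<open>i\<close> becomes a strict one on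
    \<open>i - 1\<close>.\<close>
  then have "n (Suc (i - 1)) = ?g (i - 1) \<and> ?g (i - 1) \<le> L"
    using n i pP
    by (intro strict_mono_eq_initial_segment[of "\<lambda>j. n (Suc j)"])
       (auto simp: expansion_iff strict_mono_def strict_mono_on_def nth_prime_less_iff)
  moreover from this have "?g (i - 1) \<in> pP (k + 1)"
    unfolding pP by blast
  ultimately show "n i = nth_prime (k + i)" "n i \<in> pP (k + 1)"
    using i by auto
qed

end
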